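(* Let $q\ge 1$ and, for each $k=1,\dots,q$, let $\Omega_k=\{\omega_{pk}: p=1,2,3,\dots\}\subset\mathbb{R}$ be a countable set of angular frequencies, let $e_{pk}(t)=\exp(j\omega_{pk}t)$ with $j^2=-1$ be the corresponding orthonormal system in the Hilbert space $B_2(-\infty,+\infty)$ of Besicovitch almost periodic functions, and let $$V_k=\Big\{x\in B_2(-\infty,+\infty):\ x=\sum_{p} a_{p}\,e_{pk}\Big\}$$ be the infinite set of functions spanned by the system $\{e_{pk}\}_p$. If the system of sets of functions $\mathbb{R}=\bigcup_{k=1}^{q}V_k$ is a semiring, then the system of frequency sets $\bigcup_{k=1}^{q}\Omega_k$ is a semiring as well, i.e. $\Omega_k\cap\Omega_l=\emptyset$ for all $k\neq l$.
   Context: $B_2(-\infty,+\infty)$ is the Hilbert space of (complex-valued) almost periodic functions in the sense of Besicovitch, with scalar product $(x,y)=M\{x\,\overline{y}\}$, where $M\{f\}=\lim_{T\to\infty}\frac{1}{2T}\int_{-T}^{T}f(t)\,dt$; functions at distance zero are identified. In it the functions $\exp(j\omega t)$, $\omega\in\mathbb{R}$, form an orthonormal family. The sums $\sum_p a_p e_{pk}$ are taken over complex coefficients with $\sum_p|a_p|^2<\infty$ and converge in $B_2(-\infty,+\infty)$. Terminology (the paper's): a system of sets written as a union $\bigcup_k V_k$ is called a semiring if the constituent sets are pairwise disjoint, $V_k\cap V_l=\emptyset$ for all $k\ne l$. For sets of functions that are linear spans, disjointness is understood as having no common nonzero element, i.e. $V_k\cap V_l=\{0\}$. For sets of numbers $\Omega_k$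 it means $\Omega_k\cap\Omega_l=\emptyset$ literally. *)

theory Defs
  imports "HOL-Analysis.Analysis"
begin

definition harmonic :: "real \<Rightarrow> real \<Rightarrow> complex" where
  "harmonic \<omega> t = exp (\<i> * of_real (\<omega> * t))"

definition trig_polynomials :: "(real \<Rightarrow> complex) set" where
  "trig_polynomials =
    {P. \<exists>S c. finite S \<and> P = (\<lambda>t. \<Sum>\<omega>\<in>S. c \<omega> * harmonic \<omega> t)}"

definition mean_value :: "(real \<Rightarrow> complex) \<Rightarrow> complex" where
  "mean_value f = Lim at_top (\<lambda>T. (LINT t:{-T..T}|lebesgue. f t) / of_real (2 * T))"

definition upper_mean_square :: "(real \<Rightarrow> complex) \<Rightarrow> ennreal" where
  "upper_mean_square f =
    Limsup at_top (\<lambda>T. (\<integral>\<^sup>+ t\<in>{-T..T}. ennreal ((cmod (f t))\<^sup>2) \<partial>lebesgue) / ennreal (2 * T))"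

(* Besicovitch's class: the closure of the trigonometric polynomials in the upper mean-square
   seminorm.  Members are automatically locally square integrable, because their upper mean
   square is finite.  The elements of the Hilbert space are classes of such functions; sets of
   elements are represented below by the sets of all their representatives. *)
definition B2 :: "(real \<Rightarrow> complex) set" where
  "B2 = {f \<in> borel_measurable lebesgue.
    \<forall>\<epsilon>>0. \<exists>P\<in>trig_polynomials. upper_mean_square (\<lambda>t. f t - P t) < \<epsilon>}"

(* For x and y in B2 the limit in mean_value exists; in particular (x, x) is the upper mean
   square of x, so the norm below induces the topology in which B2 is a closure. *)
definition B2_inner :: "(real \<Rightarrow> complex) \<Rightarrow> (real \<Rightarrow> complex) \<Rightarrow> complex" where
  "B2_inner x y = mean_value (\<lambda>t. x t * cnj (y t))"

definition B2_norm :: "(real \<Rightarrow> complex) \<Rightarrow> real" where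
  "B2_norm x = sqrt (Re (B2_inner x x))"

definition B2_dist :: "(real \<Rightarrow> complex) \<Rightarrow> (real \<Rightarrow> complex) \<Rightarrow> real" where
  "B2_dist x y = B2_norm (\<lambda>t. x t - y t)"

(* The zero element of the Hilbert space, as a class of functions. *)
definition B2_zero :: "(real \<Rightarrow> complex) set" where
  "B2_zero = {x \<in> B2. B2_dist x (\<lambda>_. 0) = 0}"

definition B2_span :: "(nat \<Rightarrow> real \<Rightarrow> complex) \<Rightarrow> (real \<Rightarrow> complex) set" where
  "B2_span e = {x \<in> B2. \<exists>a :: nat \<Rightarrow> complex.
    summable (\<lambda>p. (cmod (a p))\<^sup>2) \<and>
    (\<lambda>n. B2_dist x (\<lambda>t. \<Sum>p<n. a p * e p t)) \<longlonglongrightarrow> 0}"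

(* "Semiring" here is not the algebraic structure: it means that the listed sets are pairwise
   disjoint, where sets of functions are disjoint if they share only the zero element. *)
definition function_semiring :: "'i set \<Rightarrow> ('i \<Rightarrow> (real \<Rightarrow> complex) set) \<Rightarrow> bool" where
  "function_semiring I V \<longleftrightarrow> (\<forall>k\<in>I. \<forall>l\<in>I. k \<noteq> l \<longrightarrow> V k \<inter> V l = B2_zero)"

definition frequency_semiring :: "'i set \<Rightarrow> ('i \<Rightarrow> real set) \<Rightarrow> bool" where
  "frequency_semiring I \<Omega> \<longleftrightarrow> (\<forall>k\<in>I. \<forall>l\<in>I. k \<noteq> l \<longrightarrow> \<Omega> k \<inter> \<Omega> l = {})"

end

theory Submission imports Defs begin

text \<open>
  A frequency shared by two of the sets would give an exponential lying in both spans, where it is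
  the sum with a single nonzero coefficient (lemma \<open>member_in_B2_span\<close>).  Disjointness of the spans
  would make this exponential the zero element, but its mean square is 1 because it is unimodular
  (lemma \<open>B2_norm_harmonic\<close>).
\<close>

lemma mean_value_const: "mean_value (\<lambda>_. c) = c"
proof -
  have "(LINT t:{-T..T}|lebesgue. c) / of_real (2 * T) = c" if "T > 0" for T :: real
    using that by (simp add: set_integral_const scaleR_conv_of_real)
  then have "eventually (\<lambda>T::real. (LINT t:{-T..T}|lebesgue. c) / of_real (2 * T) = c) at_top"
    by (rule eventually_mono[OF eventually_gt_at_top])
  then have "((\<lambda>T::real. (LINT t:{-T..T}|lebesgue. c) / of_real (2 * T)) \<longlongrightarrow> c) at_top"
    by (rule tendsto_eventually)
  then show ?thesis
    unfolding mean_value_def by (intro tendsto_Lim) simp_all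
qed

lemma B2_dist_self: "B2_dist x x = 0"
  by (simp add: B2_dist_def B2_norm_def B2_inner_def mean_value_const)

lemma B2_norm_harmonic: "B2_norm (harmonic w) = 1"
proof -
  have "harmonic w t * cnj (harmonic w t) = 1" for t
    by (simp add: harmonic_def complex_norm_square[symmetric])
  then show ?thesis
    by (simp add: B2_norm_def B2_inner_def mean_value_const)
qed

lemma trig_polynomial_in_B2:
  assumes "P \<in> trig_polynomials"
  shows "P \<in> B2"
proof -
  have "continuous_on UNIV P"
    using assms by (auto simp: trig_polynomials_def harmonic_def intro!: continuous_intros)
  then have "P \<in> borel_measurable lebesgue"
    by (simp add: borel_measurable_continuous_onI measurable_completion)
  moreover have "upper_mean_square (\<lambda>t. P t - P t) = 0"
    by (simp add: upper_mean_square_def Limsup_const)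
  ultimately show ?thesis
    using assms by (force simp: B2_def)
qed

lemma harmonic_in_B2: "harmonic w \<in> B2"
proof -
  have "harmonic w = (\<lambda>t. \<Sum>\<omega>\<in>{w}. 1 * harmonic \<omega> t)"
    by simp
  then have "harmonic w \<in> trig_polynomials"
    unfolding trig_polynomials_def
    by (intro CollectI exI[of _ "{w}"] exI[of _ "\<lambda>_. 1"] conjI) simp_all
  then show ?thesis
    by (rule trig_polynomial_in_B2)
qed

lemma member_in_B2_span:
  assumes "e p \<in> B2"
  shows "e p \<in> B2_span e"
proof -
  define a :: "nat \<Rightarrow> complex" where "a = (\<lambda>i. if i = p then 1 else 0)"
  have "summable (\<lambda>i. (cmod (a i))\<^sup>2)"
    by (rule summable_finite[of "{p}"]) (auto simp: a_def)
  moreover have "(\<lambda>n. B2_dist (e p) (\<lambda>t. \<Sum>i<n. a i * e i t)) \<longlonglongrightarrow> 0"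
  proof (rule tendsto_eventually)
    have "(\<lambda>t. \<Sum>i<n. a i * e i t) = e p" if "n > p" for n
    proof
      fix t
      have "(\<Sum>i<n. a i * e i t) = (\<Sum>i<n. if i = p then e p t else 0)"
        by (intro sum.cong) (auto simp: a_def)
      then show "(\<Sum>i<n. a i * e i t) = e p t"
        using that by simp
    qed
    then have "B2_dist (e p) (\<lambda>t. \<Sum>i<n. a i * e i t) = 0" if "n > p" for n
      using that by (simp add: B2_dist_self)
    then show "\<forall>\<^sub>F n in sequentially. B2_dist (e p) (\<lambda>t. \<Sum>i<n. a i * e i t) = 0"
      by (rule eventually_mono[OF eventually_gt_at_top])
  qed
  ultimately show ?thesis
    using assms unfolding B2_span_def by blast
qed

theorem theorem1:
  fixes q :: nat and \<omega> :: "nat \<Rightarrow> nat \<Rightarrow> real"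
  assumes "q \<ge> 1"
    and "\<And>k. k \<in> {1..q} \<Longrightarrow> inj (\<omega> k)"
    and "function_semiring {1..q} (\<lambda>k. B2_span (\<lambda>p. harmonic (\<omega> k p)))"
  shows "frequency_semiring {1..q} (\<lambda>k. range (\<omega> k))"
  unfolding frequency_semiring_def
proof (intro ballI impI equals0I)
  fix k l w
  assume kl: "k \<in> {1..q}" "l \<in> {1..q}" "k \<noteq> l"
    and "w \<in> range (\<omega> k) \<inter> range (\<omega> l)"
  then obtain m n where w: "w = \<omega> k m" "w = \<omega> l n"
    by blast
  have "harmonic w \<in> B2_span (\<lambda>p. harmonic (\<omega> k p))"
    unfolding w(1) by (rule member_in_B2_span[OF harmonic_in_B2])
  moreover have "harmonic w \<in> B2_span (\<lambda>p. harmonic (\<omega> l p))"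
    unfolding w(2) by (rule member_in_B2_span[OF harmonic_in_B2])
  ultimately have "harmonic w \<in> B2_zero"
    using assms(3) kl unfolding function_semiring_def by blast
  then have "B2_norm (harmonic w) = 0"
    by (simp add: B2_zero_def B2_dist_def)
  then show False
    by (simp add: B2_norm_harmonic)
qed

end
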